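(* The Lie algebras $\mathcal N_{r,s}$ and $\mathcal N_{s,r}$ for $(r,s)\in\{(3,1),(3,2),(3,7),(3,11)\}$ are not isomorphic.
   Context: $\mathbb R^{r,s}$ denotes $\mathbb R^{r+s}$ with the symmetric bilinear form $\langle x,y\rangle_{r,s}=\sum_{i=1}^r x_iy_i-\sum_{j=1}^s x_{r+j}y_{r+j}$, and $\mathrm{Cl}_{r,s}$ is the Clifford algebra it generates with the convention $x\otimes x=-\langle x,x\rangle_{r,s}$. A $\mathrm{Cl}_{r,s}$-module is a finite-dimensional real vector space $U$ with a linear map $J\colon\mathbb R^{r,s}\to\mathrm{End}(U)$ such that $J_z^2=-\langle z,z\rangle_{r,s}\mathrm{Id}_U$. It is admissible if equipped with a non-degenerate symmetric bilinear form $\langle\cdot,\cdot\rangle_U$ with $\langle J_zx,y\rangle_U+\langle x,J_zy\rangle_U=0$ for all $z,x,y$; minimal admissible (denoted $V^{r,s}$) means (nonzero) admissible of the smallest possible dimension. $\mathcal N_{r,s}(U)=U\oplus\mathbb R^{r,s}$ is the 2-step nilpotent Lie algebra with centre $\mathbb R^{r,s}$ and bracket $[U,U]\subset\mathbb R^{r,s}$ given by $\langle J_zx,y\rangle_U=\langle z,[x,y]\rangle_{r,s}$. One writes $\mathcal N_{r,s}=\mathcal N_{r,s}(V^{r,s})$; up to isomorphism this does not depend on the choice of the minimal admissible module. *)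

theory Defs
  imports "HOL-Analysis.Analysis" "HOL-Analysis.Finite_Function_Topology"
begin

text \<open>
  The space of signature \<open>(r, s)\<close>, with \<open>r = CARD('r)\<close> and \<open>s = CARD('s)\<close>, is the type
  \<open>(real ^ 'r) \<times> (real ^ 's)\<close>: the first factor carries the positive, the second the negative
  coordinates. As types are nonempty, this covers \<open>r, s \<ge> 1\<close>.
\<close>

definition pseudo_inner ::
    "(real ^ 'r) \<times> (real ^ 's) \<Rightarrow> (real ^ 'r) \<times> (real ^ 's) \<Rightarrow> real" where
  "pseudo_inner x y =
    (\<Sum>i\<in>UNIV. fst x $ i * fst y $ i) - (\<Sum>j\<in>UNIV. snd x $ j * snd y $ j)"

definition linear_on :: "'a::real_vector set \<Rightarrow> ('a \<Rightarrow> 'b::real_vector) \<Rightarrow> bool" where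
  "linear_on U f \<longleftrightarrow>
    (\<forall>x\<in>U. \<forall>y\<in>U. f (x + y) = f x + f y) \<and> (\<forall>c. \<forall>x\<in>U. f (c *\<^sub>R x) = c *\<^sub>R f x)"

text \<open>
  A finite-dimensional real vector space is a finitely spanned subspace \<open>U\<close> of some ambient
  real vector space; values of \<open>J z\<close> and of bilinear forms outside \<open>U\<close> are irrelevant.
\<close>

definition findim_space :: "'u::real_vector set \<Rightarrow> bool" where
  "findim_space U \<longleftrightarrow> (\<exists>S. finite S \<and> span S = U)"

definition clifford_module ::
    "'u::real_vector set \<Rightarrow> ((real ^ 'r) \<times> (real ^ 's) \<Rightarrow> 'u \<Rightarrow> 'u) \<Rightarrow> bool" where
  "clifford_module U J \<longleftrightarrow>
    findim_space U \<and>
    (\<forall>z. J z ` U \<subseteq> U \<and> linear_on U (J z)) \<and>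
    (\<forall>x\<in>U. linear (\<lambda>z. J z x)) \<and>
    (\<forall>z. \<forall>x\<in>U. J z (J z x) = - pseudo_inner z z *\<^sub>R x)"

definition nondegenerate_symmetric_form ::
    "'u::real_vector set \<Rightarrow> ('u \<Rightarrow> 'u \<Rightarrow> real) \<Rightarrow> bool" where
  "nondegenerate_symmetric_form U B \<longleftrightarrow>
    (\<forall>x\<in>U. linear_on U (B x)) \<and>
    (\<forall>x\<in>U. \<forall>y\<in>U. B x y = B y x) \<and>
    (\<forall>x\<in>U. (\<forall>y\<in>U. B x y = 0) \<longrightarrow> x = 0)"

definition admissible_module ::
    "'u::real_vector set \<Rightarrow> ((real ^ 'r) \<times> (real ^ 's) \<Rightarrow> 'u \<Rightarrow> 'u) \<Rightarrow> ('u \<Rightarrow> 'u \<Rightarrow> real) \<Rightarrow> bool" where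
  "admissible_module U J B \<longleftrightarrow>
    clifford_module U J \<and> nondegenerate_symmetric_form U B \<and>
    (\<forall>z. \<forall>x\<in>U. \<forall>y\<in>U. B (J z x) y + B x (J z y) = 0)"

text \<open>
  A definition cannot quantify over the ambient type of the competitors \<open>W\<close>. They are taken
  inside \<open>nat \<Rightarrow>\<^sub>0 real\<close>, the real vector space of countably infinite dimension, where every
  finite-dimensional space has a copy; the lemma \<open>minimal_admissible_dim_le\<close> below shows that
  minimality then holds against competitors in every type.
\<close>

definition minimal_admissible ::
    "'u::real_vector set \<Rightarrow> ((real ^ 'r) \<times> (real ^ 's) \<Rightarrow> 'u \<Rightarrow> 'u) \<Rightarrow> ('u \<Rightarrow> 'u \<Rightarrow> real) \<Rightarrow> bool" where
  "minimal_admissible U J B \<longleftrightarrow>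
    admissible_module U J B \<and> U \<noteq> {0} \<and>
    (\<forall>(W :: (nat \<Rightarrow>\<^sub>0 real) set) (K :: (real ^ 'r) \<times> (real ^ 's) \<Rightarrow> _) C.
       admissible_module W K C \<and> W \<noteq> {0} \<longrightarrow> dim U \<le> dim W)"

definition h_bracket ::
    "((real ^ 'r) \<times> (real ^ 's) \<Rightarrow> 'u \<Rightarrow> 'u) \<Rightarrow> ('u \<Rightarrow> 'u \<Rightarrow> real) \<Rightarrow> 'u \<Rightarrow> 'u \<Rightarrow> (real ^ 'r) \<times> (real ^ 's)" where
  "h_bracket J B x y = (THE w. \<forall>z. B (J z x) y = pseudo_inner z w)"

definition N_carrier :: "'u set \<Rightarrow> ('u \<times> ((real ^ 'r) \<times> (real ^ 's))) set" where
  "N_carrier U = U \<times> UNIV"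

definition N_bracket ::
    "((real ^ 'r) \<times> (real ^ 's) \<Rightarrow> 'u::zero \<Rightarrow> 'u) \<Rightarrow> ('u \<Rightarrow> 'u \<Rightarrow> real) \<Rightarrow>
     'u \<times> ((real ^ 'r) \<times> (real ^ 's)) \<Rightarrow> 'u \<times> ((real ^ 'r) \<times> (real ^ 's)) \<Rightarrow>
     'u \<times> ((real ^ 'r) \<times> (real ^ 's))" where
  "N_bracket J B p q = (0, h_bracket J B (fst p) (fst q))"

definition lie_isomorphic ::
    "'a::real_vector set \<Rightarrow> ('a \<Rightarrow> 'a \<Rightarrow> 'a) \<Rightarrow>
     'b::real_vector set \<Rightarrow> ('b \<Rightarrow> 'b \<Rightarrow> 'b) \<Rightarrow> bool" where
  "lie_isomorphic L br L' br' \<longleftrightarrow>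
    (\<exists>f. linear_on L f \<and> bij_betw f L L' \<and> (\<forall>x\<in>L. \<forall>y\<in>L. f (br x y) = br' (f x) (f y)))"


lemma pseudo_inner_eq: "pseudo_inner x y = fst x \<bullet> fst y - snd x \<bullet> snd y"
  by (simp add: pseudo_inner_def inner_vec_def)

lemma h_bracket_unique:
  fixes w w' :: "(real ^ 'r) \<times> (real ^ 's)"
  assumes "\<And>z. pseudo_inner z w = pseudo_inner z w'"
  shows "w = w'"
proof -
  have "pseudo_inner (fst w - fst w', - (snd w - snd w')) w =
      pseudo_inner (fst w - fst w', - (snd w - snd w')) w'"
    by (rule assms)
  then have "(fst w - fst w') \<bullet> (fst w - fst w') + (snd w - snd w') \<bullet> (snd w - snd w') = 0"
    by (simp add: pseudo_inner_eq inner_diff_left inner_diff_right algebra_simps inner_commute)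
  then have "(fst w - fst w') \<bullet> (fst w - fst w') = 0" "(snd w - snd w') \<bullet> (snd w - snd w') = 0"
    by (smt (verit) inner_ge_zero)+
  then show ?thesis by (simp add: prod_eq_iff)
qed

lemma h_bracket_eq:
  fixes J :: "(real ^ 'r) \<times> (real ^ 's) \<Rightarrow> 'u::real_vector \<Rightarrow> 'u"
  assumes adm: "admissible_module U J B" and x: "x \<in> U" and y: "y \<in> U"
  shows "pseudo_inner z (h_bracket J B x y) = B (J z x) y"
proof -
  let ?g = "\<lambda>z. B (J z x) y"
  have B: "linear_on U (B y)" "\<And>a. a \<in> U \<Longrightarrow> B a y = B y a"
    and J: "\<And>z. J z x \<in> U" "linear (\<lambda>z. J z x)"
    using adm x y
    by (auto simp: admissible_module_def nondegenerate_symmetric_form_def clifford_module_def)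
  have Badd: "\<And>a a'. a \<in> U \<Longrightarrow> a' \<in> U \<Longrightarrow> B y (a + a') = B y a + B y a'"
    and Bscale: "\<And>c a. a \<in> U \<Longrightarrow> B y (c *\<^sub>R a) = c *\<^sub>R B y a"
    using B(1) by (auto simp: linear_on_def)
  have Uadd: "\<And>a a'. a \<in> U \<Longrightarrow> a' \<in> U \<Longrightarrow> a + a' \<in> U"
    and Uscale: "\<And>c a. a \<in> U \<Longrightarrow> c *\<^sub>R a \<in> U"
    using adm by (auto simp: admissible_module_def clifford_module_def findim_space_def
        intro: span_add span_scale)
  have "linear ?g"
    by (rule linearI)
      (simp_all add: B(2) J(1) linear_add[OF J(2)] linear_scale[OF J(2)] Uadd Uscale Badd Bscale)
  then have g: "?g z = z \<bullet> adjoint ?g 1" for z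
    using adjoint_works[of ?g z 1] by simp
  let ?w = "(fst (adjoint ?g 1), - snd (adjoint ?g 1))"
  have w: "\<forall>z. ?g z = pseudo_inner z ?w"
    by (subst g) (simp add: pseudo_inner_eq inner_prod_def)
  have "\<forall>z. ?g z = pseudo_inner z (h_bracket J B x y)"
    unfolding h_bracket_def
    by (rule theI[of "\<lambda>w. \<forall>z. ?g z = pseudo_inner z w", OF w]) (metis h_bracket_unique w)
  then show ?thesis by metis
qed

lemma minimal_admissible_dim_le:
  fixes J :: "(real ^ 'r) \<times> (real ^ 's) \<Rightarrow> 'u::real_vector \<Rightarrow> 'u"
    and K :: "(real ^ 'r) \<times> (real ^ 's) \<Rightarrow> 'w::real_vector \<Rightarrow> 'w"
  assumes min: "minimal_admissible U J B" and adm: "admissible_module W K C" and "W \<noteq> {0}"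
  shows "dim U \<le> dim W"
proof -
  have cl: "clifford_module W K" and nd: "nondegenerate_symmetric_form W C"
    and sk: "\<And>z x y. x \<in> W \<Longrightarrow> y \<in> W \<Longrightarrow> C (K z x) y + C x (K z y) = 0"
    using adm by (auto simp: admissible_module_def)
  obtain S where S: "finite S" "span S = W"
    using cl by (auto simp: clifford_module_def findim_space_def)
  obtain b where b: "b \<subseteq> S" "independent b" "span b = W"
    using maximal_independent_subset[of S] S(2)
    by (metis span_mono span_span subset_antisym)
  have fb: "finite b" using b(1) S(1) finite_subset by blast
  obtain h :: "'w \<Rightarrow> nat" where h: "inj_on h b"
    using finite_imp_inj_to_nat_seg[OF fb] by blast
  define e :: "'w \<Rightarrow> nat \<Rightarrow>\<^sub>0 real" where "e v = Poly_Mapping.single (h v) 1" for v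
  obtain f where f: "linear f" "\<And>v. v \<in> b \<Longrightarrow> f v = e v"
    using linear_independent_extend[OF b(2), of e] by blast
  have lookup_scaleR: "Poly_Mapping.lookup (c *\<^sub>R p) i = c * Poly_Mapping.lookup p i"
    for c and p :: "nat \<Rightarrow>\<^sub>0 real" and i
  proof -
    have "finite {i. c *\<^sub>R Poly_Mapping.lookup p i \<noteq> 0}"
      by (rule finite_subset[OF _ finite_keys[of p]]) (auto simp: in_keys_iff)
    then show ?thesis by (simp add: scaleR_poly_mapping_def)
  qed
  have look: "Poly_Mapping.lookup (\<Sum>v\<in>b. u v *\<^sub>R e v) (h a) = u a" if "a \<in> b" for u a
  proof -
    have "Poly_Mapping.lookup (\<Sum>v\<in>b. u v *\<^sub>R e v) (h a) = (\<Sum>v\<in>b. if v = a then u v else 0)"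
      unfolding lookup_sum
      by (rule sum.cong[OF refl])
        (use h that in \<open>auto simp: e_def lookup_single lookup_scaleR when_def inj_on_eq_iff\<close>)
    then show ?thesis using that fb by simp
  qed
  have inj0: "x = 0" if xW: "x \<in> W" and "f x = 0" for x
  proof -
    obtain u where u: "x = (\<Sum>v\<in>b. u v *\<^sub>R v)"
      using xW b(3) span_finite[OF fb] by auto
    then have "f x = (\<Sum>v\<in>b. u v *\<^sub>R e v)"
      by (simp add: linear_sum[OF f(1)] linear_scale[OF f(1)] f(2))
    then have "u a = 0" if "a \<in> b" for a
      using look[OF that, of u] \<open>f x = 0\<close> by simp
    then show ?thesis using u by simp
  qed
  have sub: "subspace W" using b(3) by auto
  have inj: "inj_on f W"
    by (rule inj_onI) (metis inj0 sub subspace_diff linear_diff[OF f(1)] eq_iff_diff_eq_0)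
  define g where "g = inv_into W f"
  have gf: "g (f x) = x" if "x \<in> W" for x
    using inj that by (simp add: g_def)
  let ?W = "f ` W" and ?K = "\<lambda>z w. f (K z (g w))" and ?C = "\<lambda>v w. C (g v) (g w)"
  have KW: "K z x \<in> W" if "x \<in> W" for z x
    using cl that unfolding clifford_module_def by blast
  have Klin: "linear_on W (K z)" for z
    using cl unfolding clifford_module_def by blast
  have Kadd: "K z (x + y) = K z x + K z y" if "x \<in> W" "y \<in> W" for z x y
    using Klin that unfolding linear_on_def by blast
  have Ksc: "K z (c *\<^sub>R x) = c *\<^sub>R K z x" if "x \<in> W" for z c x
    using Klin that unfolding linear_on_def by blast
  have KK: "K z (K z x) = - pseudo_inner z z *\<^sub>R x" if "x \<in> W" for z x
    using cl that unfolding clifford_module_def by blast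
  have gadd: "g (f x + f y) = x + y" if "x \<in> W" "y \<in> W" for x y
    using gf[of "x + y"] that sub by (simp add: linear_add[OF f(1)] subspace_add)
  have gsc: "g (c *\<^sub>R f x) = c *\<^sub>R x" if "x \<in> W" for c x
    using gf[of "c *\<^sub>R x"] that sub by (simp add: linear_scale[OF f(1)] subspace_scale)
  have "findim_space ?W"
    unfolding findim_space_def
    by (rule exI[of _ "f ` S"]) (use S linear_span_image[OF f(1), of S] in simp)
  moreover have "?K z ` ?W \<subseteq> ?W" for z by (auto simp: gf intro!: imageI KW)
  moreover have "linear_on ?W (?K z)" for z
    by (auto simp: linear_on_def KW gf gadd gsc Kadd Ksc linear_add[OF f(1)] linear_scale[OF f(1)])
  moreover have "linear (\<lambda>z. ?K z w)" if "w \<in> ?W" for w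
  proof -
    have "linear (\<lambda>z. K z (g w))" using that cl unfolding clifford_module_def by (metis gf imageE)
    then show ?thesis using linear_compose[OF _ f(1)] by (auto simp: o_def)
  qed
  moreover have "?K z (?K z w) = - pseudo_inner z z *\<^sub>R w" if "w \<in> ?W" for z w
    using that by (auto simp: KW gf KK linear_neg[OF f(1)] linear_scale[OF f(1)])
  ultimately have "clifford_module ?W ?K" by (simp add: clifford_module_def)
  moreover have "nondegenerate_symmetric_form ?W ?C"
    using nd linear_0[OF f(1)]
    by (auto simp: nondegenerate_symmetric_form_def linear_on_def gf gadd gsc)
  moreover have "?C (?K z v) w + ?C v (?K z w) = 0" if "v \<in> ?W" "w \<in> ?W" for z v w
    using that by (auto simp: KW gf sk)
  ultimately have "admissible_module ?W ?K ?C" by (simp add: admissible_module_def)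
  moreover have "?W \<noteq> {0}"
    using \<open>W \<noteq> {0}\<close> inj0 subspace_0[OF sub] by blast
  ultimately have "dim U \<le> dim ?W" using min unfolding minimal_admissible_def by blast
  also have "dim ?W \<le> dim W"
  proof -
    have "?W = span (f ` b)" using linear_span_image[OF f(1), of b] b(3) by simp
    then have "dim ?W \<le> card (f ` b)" using dim_le_card[of ?W "f ` b"] fb by simp
    also have "\<dots> \<le> card b" using fb by (rule card_image_le)
    also have "card b = dim W" using b(2,3) dim_span_eq_card_independent by metis
    finally show ?thesis .
  qed
  finally show ?thesis .
qed

end

theory Submission
  imports Defs
begin

text \<open>
  Let \<open>e1, e2, e3\<close> be the positive unit vectors of signature \<open>(3, s)\<close> and put
  \<open>\<Omega> = J e1 \<circ> J e2 \<circ> J e3\<close>. The form \<open>\<Phi> x y = B x (\<Omega> y)\<close> is symmetric, non-degenerate and invariant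
  under \<open>J b\<close> for every basis vector \<open>b\<close>, of either sign. Let \<open>Q\<close> be a positive definite form with the
  same invariance. For an eigenvalue \<open>t\<close> of \<open>\<Phi>\<close> relative to \<open>Q\<close>, the eigenspace is a submodule on which
  \<open>\<Phi> = t Q\<close>, hence an admissible one, so minimality makes it all of \<open>U\<close>: the form \<open>\<Phi>\<close> is definite.

  A Lie algebra isomorphism yields a linear bijection \<open>A : V \<rightarrow> U\<close> and a linear map \<open>h\<close> of the centres with
  \<open>B (J z (A x)) (A y) = C (K (h z) x) y\<close>. Since \<open>z\<close> is null iff \<open>J z\<close> is singular, \<open>h\<close> respects null
  cones, and as \<open>r \<noteq> s\<close> it multiplies the quadratic form by some \<open>- \<mu> < 0\<close>. With
  \<open>M z = A \<circ> K (h z) \<circ> A\<inverse>\<close>, the operator \<open>R = J e \<circ> M e\<close> is the same for \<open>e = e1, e2, e3\<close>, and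
  \<open>\<Phi> (R x) (R x) = - \<mu> \<Phi> x x\<close>, which contradicts definiteness.
\<close>

section \<open>Symmetric bilinear forms on a subspace\<close>

locale sym_form =
  fixes U :: "'u::real_vector set" and H :: "'u \<Rightarrow> 'u \<Rightarrow> real"
  assumes subspace: "subspace U"
    and linear_on: "x \<in> U \<Longrightarrow> linear_on U (H x)"
    and sym: "x \<in> U \<Longrightarrow> y \<in> U \<Longrightarrow> H x y = H y x"
begin

lemma add_right: "x \<in> U \<Longrightarrow> y \<in> U \<Longrightarrow> z \<in> U \<Longrightarrow> H x (y + z) = H x y + H x z"
  and scale_right: "x \<in> U \<Longrightarrow> y \<in> U \<Longrightarrow> H x (c *\<^sub>R y) = c * H x y"
  using linear_on by (auto simp: linear_on_def)

lemma add_left: "x \<in> U \<Longrightarrow> y \<in> U \<Longrightarrow> z \<in> U \<Longrightarrow> H (x + y) z = H x z + H y z"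
  and scale_left: "x \<in> U \<Longrightarrow> y \<in> U \<Longrightarrow> H (c *\<^sub>R x) y = c * H x y"
  using add_right scale_right sym subspace by (metis subspace_add, metis subspace_scale)

lemma minus_right: "x \<in> U \<Longrightarrow> y \<in> U \<Longrightarrow> H x (- y) = - H x y"
  and minus_left: "x \<in> U \<Longrightarrow> y \<in> U \<Longrightarrow> H (- x) y = - H x y"
  using scale_right[of x y "-1"] scale_left[of x y "-1"] by auto

lemma diff_left: "x \<in> U \<Longrightarrow> y \<in> U \<Longrightarrow> z \<in> U \<Longrightarrow> H (x - y) z = H x z - H y z"
  using add_left[of x "- y" z] minus_left subspace subspace_neg by fastforce

lemma zero_right: "x \<in> U \<Longrightarrow> H x 0 = 0" and zero_left: "x \<in> U \<Longrightarrow> H 0 x = 0"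
  using scale_right[of x x 0] scale_left[of x x 0] by auto

lemmas bilinear_simps = add_right scale_right add_left scale_left minus_right minus_left
  diff_left zero_right zero_left
lemmas closed = subspace_add[OF subspace] subspace_scale[OF subspace] subspace_neg[OF subspace]
  subspace_diff[OF subspace] subspace_0[OF subspace]

text \<open>As in the Cauchy-Schwarz inequality: on the line through \<open>y\<close> in the null
  direction \<open>a\<close> the form is affine in the parameter, so it stays non-negative only if
  its slope \<open>2 * H a y\<close> vanishes.\<close>

lemma null_vector_in_radical:
  assumes nonneg: "\<And>x. x \<in> U \<Longrightarrow> 0 \<le> H x x" and a: "a \<in> U" "H a a = 0" and y: "y \<in> U"
  shows "H a y = 0"
proof (rule ccontr)
  assume n: "H a y \<noteq> 0"
  \<comment> \<open>The parameter at which this affine function takes the value -1.\<close>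
  define c where "c = - (H y y + 1) / (2 * H a y)"
  have "0 \<le> H (y + c *\<^sub>R a) (y + c *\<^sub>R a)"
    by (intro nonneg closed a y)
  also have "\<dots> = H y y + 2 * c * H a y + c\<^sup>2 * H a a"
    using a y sym[of y a] by (simp only: bilinear_simps closed) (simp add: power2_eq_square algebra_simps)
  also have "\<dots> = -1" using n a by (simp add: c_def field_simps)
  finally show False by simp
qed

end

section \<open>Positive definite forms: projections, bounds and relative eigenvectors\<close>

locale pos_form = sym_form +
  assumes pos: "x \<in> U \<Longrightarrow> x \<noteq> 0 \<Longrightarrow> 0 < H x x"
begin

lemma nonneg: "x \<in> U \<Longrightarrow> 0 \<le> H x x"
  using pos zero_right by (cases "x = 0") (auto simp: less_imp_le)

text \<open>Gram-Schmidt, one generator at a time: \<open>b'\<close> is the part of \<open>b\<close>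
  orthogonal to \<open>span S\<close>, and the projection to the larger span adds a multiple of
  \<open>b'\<close>.\<close>

lemma orthogonal_projection:
  assumes "finite S" "S \<subseteq> U" "a \<in> U"
  shows "\<exists>p\<in>span S. \<forall>y\<in>span S. H (a - p) y = 0"
  using assms
proof (induction S arbitrary: a)
  case empty
  then show ?case by (simp add: zero_right)
next
  case (insert b S)
  have sub: "span S \<subseteq> U" using insert.prems subspace by (simp add: span_minimal)
  obtain q where q: "q \<in> span S" "\<And>y. y \<in> span S \<Longrightarrow> H (b - q) y = 0"
    using insert.IH[of b] insert.prems by auto
  obtain p where p: "p \<in> span S" "\<And>y. y \<in> span S \<Longrightarrow> H (a - p) y = 0"
    using insert.IH[of a] insert.prems by auto
  define b' where "b' = b - q"
  have U: "a \<in> U" "b \<in> U" "p \<in> U" "q \<in> U" "b' \<in> U"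
    using insert.prems p q sub closed by (auto simp: b'_def)
  \<comment> \<open>For \<open>b' = 0\<close> the division by zero gives \<open>k = 0\<close>, and
    the equation below still holds.\<close>
  define k where "k = H (a - p) b' / H b' b'"
  have k: "H (a - p) b' = k * H b' b'"
    using pos[OF U(5)] U by (cases "b' = 0") (auto simp: k_def zero_right closed)
  have b': "b' \<in> span (insert b S)"
    unfolding b'_def using q(1) by (meson span_diff span_superset insertI1 span_mono subset_iff subset_insertI)
  show ?case
  proof (intro bexI ballI)
    show "p + k *\<^sub>R b' \<in> span (insert b S)"
      using b' p(1) by (meson span_add span_scale span_mono subset_iff subset_insertI)
    fix y assume "y \<in> span (insert b S)"
    then obtain c where c: "y - c *\<^sub>R b \<in> span S" by (auto simp: span_insert)
    define w where "w = y - c *\<^sub>R b + c *\<^sub>R q"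
    have w: "w \<in> span S" using c q(1) by (simp add: w_def span_add span_scale)
    then have wU: "w \<in> U" using sub by auto
    have y: "y = w + c *\<^sub>R b'" by (simp add: w_def b'_def algebra_simps)
    have "H (a - p - k *\<^sub>R b') (w + c *\<^sub>R b') =
        H (a - p) w - k * H b' w + c * (H (a - p) b' - k * H b' b')"
      using U wU by (simp add: bilinear_simps closed algebra_simps)
    also have "\<dots> = 0" using p(2)[OF w] q(2)[OF w] k by (simp add: b'_def)
    finally show "H (a - (p + k *\<^sub>R b')) y = 0" by (simp add: y algebra_simps)
  qed
qed

text \<open>The orthogonal splitting behind the inductions below. The generators may be dependent,
  so \<open>b'\<close> may be zero.\<close>

lemma span_insert_orthogonal:
  assumes "finite S" "insert b S \<subseteq> U"
  obtains b' where "b' \<in> U"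
    "\<And>y. y \<in> span S \<Longrightarrow> H b' y = 0"
    "\<And>x. x \<in> span (insert b S) \<Longrightarrow> \<exists>y\<in>span S. \<exists>c. x = y + c *\<^sub>R b'"
proof -
  obtain q where q: "q \<in> span S" "\<And>y. y \<in> span S \<Longrightarrow> H (b - q) y = 0"
    using orthogonal_projection[of S b] assms by auto
  have "q \<in> U" using q(1) assms subspace span_minimal[of S U] by auto
  show thesis
  proof (rule that[of "b - q"])
    show "b - q \<in> U" using assms \<open>q \<in> U\<close> closed by auto
    show "H (b - q) y = 0" if "y \<in> span S" for y using q(2) that .
    fix x assume "x \<in> span (insert b S)"
    then obtain c where c: "x - c *\<^sub>R b \<in> span S" by (auto simp: span_insert)
    have "x - c *\<^sub>R b + c *\<^sub>R q \<in> span S" using c q(1) by (intro span_add span_scale)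
    then show "\<exists>y\<in>span S. \<exists>c. x = y + c *\<^sub>R (b - q)"
      by (rule bexI[rotated]) (auto intro!: exI[of _ c] simp: algebra_simps)
  qed
qed

text \<open>The ambient type has no norm, so boundedness is proved algebraically: the square of a
  sum is at most twice the sum of the squares, and each square is bounded by one orthogonal summand
  of \<open>H x x\<close>.\<close>

lemma functional_bound:
  assumes "finite S" "S \<subseteq> U" and l: "linear_on U l"
  shows "\<exists>k. \<forall>x\<in>span S. (l x)\<^sup>2 \<le> k * H x x"
  using assms(1,2)
proof (induction S)
  case empty
  have "l 0 = 0" using l closed(5) unfolding linear_on_def by (metis scaleR_zero_left real_scaleR_def mult_zero_left)
  then show ?case by (simp add: zero_right closed)
next
  case (insert b S)
  obtain k where k: "\<And>x. x \<in> span S \<Longrightarrow> (l x)\<^sup>2 \<le> k * H x x" using insert by auto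
  obtain b' where b': "b' \<in> U" "\<And>y. y \<in> span S \<Longrightarrow> H b' y = 0"
    "\<And>x. x \<in> span (insert b S) \<Longrightarrow> \<exists>y\<in>span S. \<exists>c. x = y + c *\<^sub>R b'"
    using span_insert_orthogonal insert.hyps(1) insert.prems by metis
  have sub: "span S \<subseteq> U" using insert.prems subspace by (simp add: span_minimal)
  define m where "m = (l b')\<^sup>2 / H b' b'"
  have l0: "l 0 = 0" using l closed(5) unfolding linear_on_def by (metis scaleR_zero_left real_scaleR_def mult_zero_left)
  have m: "(l b')\<^sup>2 = m * H b' b'"
    using pos[OF b'(1)] b'(1) l0 by (cases "b' = 0") (auto simp: m_def zero_right closed)
  show ?case
  proof (intro exI ballI)
    fix x assume "x \<in> span (insert b S)"
    then obtain y c where y: "y \<in> span S" and x: "x = y + c *\<^sub>R b'" using b'(3) by metis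
    have yU: "y \<in> U" using y sub by auto
    have H: "H x x = H y y + c\<^sup>2 * H b' b'"
      using b'(1) yU b'(2)[OF y] sym[of y b'] by (simp add: x bilinear_simps closed power2_eq_square algebra_simps)
    have lx: "l x = l y + c * l b'" using l yU b'(1) closed unfolding linear_on_def x by simp
    have "(l x)\<^sup>2 \<le> 2 * (l y)\<^sup>2 + 2 * (c\<^sup>2 * (l b')\<^sup>2)"
      using zero_le_power2[of "l y - c * l b'"] unfolding lx by (simp add: power2_eq_square algebra_simps)
    also have "\<dots> \<le> 2 * (k * H y y) + 2 * (c\<^sup>2 * (m * H b' b'))" using k[OF y] m by simp
    \<comment> \<open>Each summand of \<open>H x x\<close> is at most \<open>H x x\<close>;
      \<open>max\<close> guards against negative constants.\<close>
    also have "\<dots> \<le> (2 * max k 0 + 2 * max m 0) * H x x"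
    proof -
      have "k * H y y \<le> max k 0 * H x x" "c\<^sup>2 * (m * H b' b') \<le> max m 0 * H x x"
        using nonneg[OF yU] nonneg[OF b'(1)] unfolding H
        by (auto simp: max_def algebra_simps mult_nonneg_nonneg mult_nonneg_nonpos2 mult_nonpos_nonneg
            intro: order_trans[of _ 0] add_nonneg_nonneg)
      then show ?thesis by (simp add: algebra_simps)
    qed
    finally show "(l x)\<^sup>2 \<le> (2 * max k 0 + 2 * max m 0) * H x x" .
  qed
qed

text \<open>The same induction. The mixed term is at most
  \<open>c\<^sup>2 + (P b' y)\<^sup>2\<close>, and \<open>functional_bound\<close> controls the
  second square.\<close>

lemma form_bound:
  assumes "finite S" "S \<subseteq> U" and P: "sym_form U P"
  shows "\<exists>k. \<forall>x\<in>span S. P x x \<le> k * H x x"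
  using assms(1,2)
proof (induction S)
  case empty
  then show ?case using sym_form.zero_right[OF P] by (simp add: zero_right closed)
next
  case (insert b S)
  interpret P: sym_form U P by fact
  obtain k where k: "\<And>x. x \<in> span S \<Longrightarrow> P x x \<le> k * H x x" using insert by auto
  obtain b' where b': "b' \<in> U" "\<And>y. y \<in> span S \<Longrightarrow> H b' y = 0"
    "\<And>x. x \<in> span (insert b S) \<Longrightarrow> \<exists>y\<in>span S. \<exists>c. x = y + c *\<^sub>R b'"
    using span_insert_orthogonal insert.hyps(1) insert.prems by metis
  obtain n where n: "\<And>x. x \<in> span S \<Longrightarrow> (P b' x)\<^sup>2 \<le> n * H x x"
    using functional_bound[OF insert.hyps(1) _ P.linear_on[OF b'(1)]] insert.prems by auto
  have sub: "span S \<subseteq> U" using insert.prems subspace by (simp add: span_minimal)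
  show ?case
  proof (cases "b' = 0")
    case True
    then show ?thesis using b'(3) k by (metis scaleR_zero_right add.right_neutral)
  next
    case False
    \<comment> \<open>The \<open>1\<close> pays for the \<open>c\<^sup>2\<close> from the mixed
      term; \<open>H b' b'\<close> can absorb it since \<open>b'\<close> is nonzero here.\<close>
    define m where "m = (1 + P b' b') / H b' b'"
    have m: "1 + P b' b' = m * H b' b'" using pos[OF b'(1) False] by (simp add: m_def)
    show ?thesis
    proof (intro exI ballI)
      fix x assume "x \<in> span (insert b S)"
      then obtain y c where y: "y \<in> span S" and x: "x = y + c *\<^sub>R b'" using b'(3) by metis
      have yU: "y \<in> U" using y sub by auto
      have H: "H x x = H y y + c\<^sup>2 * H b' b'"
        using b'(1) yU b'(2)[OF y] sym[of y b'] by (simp add: x bilinear_simps closed power2_eq_square algebra_simps)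
      have "P x x = P y y + 2 * c * P b' y + c\<^sup>2 * P b' b'"
        using b'(1) yU P.sym[of y b'] by (simp add: x P.bilinear_simps closed power2_eq_square algebra_simps)
      also have "\<dots> \<le> P y y + (P b' y)\<^sup>2 + c\<^sup>2 * (1 + P b' b')"
        using zero_le_power2[of "c - P b' y"] by (simp add: power2_eq_square algebra_simps)
      also have "\<dots> \<le> k * H y y + n * H y y + c\<^sup>2 * (m * H b' b')" using k[OF y] n[OF y] m by simp
      also have "\<dots> \<le> (max k 0 + max n 0 + max m 0) * H x x"
      proof -
        have "k * H y y \<le> max k 0 * H x x" "n * H y y \<le> max n 0 * H x x"
          "c\<^sup>2 * (m * H b' b') \<le> max m 0 * H x x"
          using nonneg[OF yU] nonneg[OF b'(1)] unfolding H
          by (auto simp: max_def algebra_simps mult_nonneg_nonneg mult_nonneg_nonpos2 mult_nonpos_nonneg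
              intro: order_trans[of _ 0] add_nonneg_nonneg)
        then show ?thesis by (simp add: algebra_simps)
      qed
      finally show "P x x \<le> (max k 0 + max n 0 + max m 0) * H x x" .
    qed
  qed
qed

text \<open>The eigenvalue is the supremum \<open>M\<close> of the Rayleigh quotient. The form
  \<open>M * H - P\<close> is non-negative, so a vector on which it vanishes lies in its radical,
  which is the eigenvector equation.\<close>

lemma relative_eigenvector:
  assumes fin: "findim_space U" and nz: "U \<noteq> {0}" and P: "sym_form U P"
  obtains x t where "x \<in> U" "x \<noteq> 0" "\<forall>y\<in>U. P x y = t * H x y"
proof -
  interpret P: sym_form U P by fact
  obtain S where S: "finite S" "span S = U" using fin by (auto simp: findim_space_def)
  have SU: "S \<subseteq> U" using S(2) span_superset by auto
  obtain u where u: "u \<in> U" "u \<noteq> 0" using nz closed(5) by auto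
  define Q where "Q = (\<lambda>x. P x x / H x x) ` (U - {0})"
  obtain k where k: "\<And>x. x \<in> U \<Longrightarrow> P x x \<le> k * H x x" using form_bound[OF S(1) SU P] S(2) by auto
  have "bdd_above Q"
  proof (rule bdd_aboveI[of _ k])
    fix q assume "q \<in> Q"
    then obtain x where "x \<in> U" "x \<noteq> 0" "q = P x x / H x x" by (auto simp: Q_def)
    then show "q \<le> k" using k[of x] pos[of x] by (simp add: pos_divide_le_eq)
  qed
  define M where "M = Sup Q"
  have le: "P x x \<le> M * H x x" if "x \<in> U" for x
  proof (cases "x = 0")
    case False
    then have "P x x / H x x \<le> M"
      unfolding M_def by (intro cSup_upper \<open>bdd_above Q\<close>) (use that in \<open>auto simp: Q_def\<close>)
    then show ?thesis using pos[OF that False] by (simp add: divide_le_eq)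
  qed (use that in \<open>simp add: bilinear_simps P.bilinear_simps\<close>)
  define D where "D x y = M * H x y - P x y" for x y
  interpret D: sym_form U D
    by standard (auto simp: D_def linear_on_def bilinear_simps P.bilinear_simps algebra_simps sym P.sym
        subspace)
  \<comment> \<open>If \<open>D\<close> were positive definite, it would dominate a multiple of \<open>H\<close>, and \<open>M\<close> could be lowered.\<close>
  have "\<exists>x\<in>U - {0}. D x x \<le> 0"
  proof (rule ccontr)
    assume "\<not> ?thesis"
    then interpret D: pos_form U D by unfold_locales force
    \<comment> \<open>\<open>form_bound\<close> with \<open>H\<close> bounded by \<open>D\<close>:
      dividing by \<open>m * H x x\<close> shows that every quotient is at most
      \<open>M - 1 / m\<close>.\<close>
    obtain m where m: "\<And>x. x \<in> U \<Longrightarrow> H x x \<le> m * D x x"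
      using D.form_bound[OF S(1) SU sym_form_axioms] S(2) by auto
    have "0 < m * D u u" using m[OF u(1)] pos[OF u] by simp
    then have "m > 0" using D.pos[OF u] by (simp add: zero_less_mult_iff)
    have "M \<le> M - 1 / m"
      unfolding M_def
    proof (rule cSup_least)
      show "Q \<noteq> {}" using u by (auto simp: Q_def)
      fix q assume "q \<in> Q"
      then obtain x where x: "x \<in> U" "x \<noteq> 0" and q: "q = P x x / H x x" by (auto simp: Q_def)
      show "q \<le> Sup Q - 1 / m"
        using m[OF x(1)] pos[OF x] \<open>m > 0\<close> unfolding M_def[symmetric] D_def q
        by (simp add: field_simps)
    qed
    then show False using \<open>m > 0\<close> by simp
  qed
  then obtain x where x: "x \<in> U" "x \<noteq> 0" "D x x = 0"
    using le by (fastforce simp: D_def)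
  have "D x y = 0" if "y \<in> U" for y
    by (rule D.null_vector_in_radical) (use x that le in \<open>auto simp: D_def\<close>)
  then show thesis using x that[of x M] by (simp add: D_def)
qed

end


text \<open>Take the dot product of coordinates with respect to a basis.\<close>

lemma positive_form_exists:
  fixes U :: "'u::real_vector set"
  assumes "findim_space U"
  shows "\<exists>Q. pos_form U Q"
proof -
  obtain S where S: "finite S" "span S = U" using assms by (auto simp: findim_space_def)
  obtain b where b: "b \<subseteq> S" "independent b" "span b = U"
    using maximal_independent_subset[of S] S(2) by (metis span_mono span_span subset_antisym)
  have fb: "finite b" using b(1) S(1) finite_subset by blast
  define Q where "Q x y = (\<Sum>v\<in>b. representation b x v * representation b y v)" for x y
  have "pos_form U Q"
  proof
    show "subspace U" using b(3) by auto
    show "linear_on U (Q x)" if "x \<in> U" for x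
      using b by (auto simp: linear_on_def Q_def representation_add representation_scale
          distrib_left sum.distrib sum_distrib_left mult.left_commute)
    show "Q x y = Q y x" for x y by (simp add: Q_def mult.commute)
    show "0 < Q x x" if x: "x \<in> U" "x \<noteq> 0" for x
    proof (rule ccontr)
      assume "\<not> 0 < Q x x"
      moreover have "0 \<le> Q x x" unfolding Q_def by (intro sum_nonneg) simp
      ultimately have "Q x x = 0" by simp
      then have "representation b x v = 0" if "v \<in> b" for v
        using that fb unfolding Q_def by (subst (asm) sum_nonneg_eq_0_iff) auto
      moreover have "(\<Sum>v\<in>b. representation b x v *\<^sub>R v) = x"
        using b x(1) fb by (intro sum_representation_eq) auto
      ultimately show False using x(2) by simp
    qed
  qed
  then show ?thesis by blast
qed

section \<open>The scalar product of signature \<open>(r, s)\<close>\<close>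

lemma pseudo_inner_sym: "pseudo_inner x y = pseudo_inner y x"
  by (simp add: pseudo_inner_eq inner_commute)

lemma pseudo_inner_add: "pseudo_inner (x + y) z = pseudo_inner x z + pseudo_inner y z"
  "pseudo_inner z (x + y) = pseudo_inner z x + pseudo_inner z y"
  by (simp_all add: pseudo_inner_eq inner_add_left inner_add_right)

lemma pseudo_inner_scale: "pseudo_inner (c *\<^sub>R x) y = c * pseudo_inner x y"
  "pseudo_inner x (c *\<^sub>R y) = c * pseudo_inner x y"
  by (simp_all add: pseudo_inner_eq algebra_simps)

lemma pseudo_inner_Basis:
  fixes b c :: "(real ^ 'r) \<times> (real ^ 's)"
  assumes "b \<in> Basis" "c \<in> Basis"
  shows "b \<noteq> c \<Longrightarrow> pseudo_inner b c = 0" "pseudo_inner b b = 1 \<or> pseudo_inner b b = - 1"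
  using assms by (auto simp: Basis_prod_def pseudo_inner_eq inner_Basis split: if_splits)

section \<open>Admissible modules, invariant forms and submodules\<close>

locale admissible =
  fixes U :: "'u::real_vector set"
    and J :: "(real ^ 'r) \<times> (real ^ 's) \<Rightarrow> 'u \<Rightarrow> 'u"
    and B :: "'u \<Rightarrow> 'u \<Rightarrow> real"
  assumes admissible: "admissible_module U J B"
begin

lemma findim: "findim_space U"
  using admissible by (simp add: admissible_module_def clifford_module_def)

sublocale B: sym_form U B
proof
  show "subspace U" using findim by (auto simp: findim_space_def)
qed (use admissible in \<open>auto simp: admissible_module_def nondegenerate_symmetric_form_def\<close>)

lemma J_closed [simp]: "x \<in> U \<Longrightarrow> J z x \<in> U"
  and J_add: "x \<in> U \<Longrightarrow> y \<in> U \<Longrightarrow> J z (x + y) = J z x + J z y"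
  and J_scale: "x \<in> U \<Longrightarrow> J z (c *\<^sub>R x) = c *\<^sub>R J z x"
  and linear_J: "x \<in> U \<Longrightarrow> linear (\<lambda>z. J z x)"
  and J_square: "x \<in> U \<Longrightarrow> J z (J z x) = - pseudo_inner z z *\<^sub>R x"
  using admissible
  unfolding admissible_module_def clifford_module_def linear_on_def image_subset_iff
  by blast+

lemma J_minus: "x \<in> U \<Longrightarrow> J z (- x) = - J z x"
  using J_scale[of x z "-1"] by simp

lemma J_zero: "J z 0 = 0"
  using J_scale[OF B.closed(5), of z 0] by simp

lemma skew: "x \<in> U \<Longrightarrow> y \<in> U \<Longrightarrow> B (J z x) y = - B x (J z y)"
  using admissible unfolding admissible_module_def eq_neg_iff_add_eq_0 by blast

lemma nondegenerate: "x \<in> U \<Longrightarrow> (\<And>y. y \<in> U \<Longrightarrow> B x y = 0) \<Longrightarrow> x = 0"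
  using admissible by (auto simp: admissible_module_def nondegenerate_symmetric_form_def)

lemma cancel:
  assumes "x \<in> U" "x' \<in> U" "\<And>y. y \<in> U \<Longrightarrow> B x y = B x' y"
  shows "x = x'"
  using nondegenerate[of "x - x'"] assms B.diff_left B.closed by simp

text \<open>Polarisation of \<open>J_square\<close>.\<close>

lemma anticommute:
  assumes x: "x \<in> U" and orth: "pseudo_inner z w = 0"
  shows "J z (J w x) = - J w (J z x)"
proof -
  have "J (z + w) (J (z + w) x) = - pseudo_inner (z + w) (z + w) *\<^sub>R x" using x by (rule J_square)
  also have "\<dots> = - pseudo_inner z z *\<^sub>R x - pseudo_inner w w *\<^sub>R x"
    using orth pseudo_inner_sym[of z w] by (simp add: pseudo_inner_add algebra_simps)
  also have "J (z + w) (J (z + w) x) = J z (J z x) + J z (J w x) + (J w (J z x) + J w (J w x))"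
    using x by (simp add: linear_add[OF linear_J] J_add)
  finally show ?thesis using x by (simp add: J_square algebra_simps eq_neg_iff_add_eq_0)
qed

lemma J_injective: "x \<in> U \<Longrightarrow> J z x = 0 \<Longrightarrow> pseudo_inner z z \<noteq> 0 \<Longrightarrow> x = 0"
  using J_square[of x z] by (simp add: J_zero)

text \<open>\<open>J z\<close> is a linear combination of the \<open>J b\<close>. This reduces
  invariance of a subspace to basis vectors, for which the forms below are invariant.\<close>

lemma invariant_of_Basis:
  assumes W: "subspace W" "W \<subseteq> U" and "\<And>b x. b \<in> Basis \<Longrightarrow> x \<in> W \<Longrightarrow> J b x \<in> W"
    and x: "x \<in> W"
  shows "J z x \<in> W"
proof -
  have "J z x = (\<Sum>b\<in>Basis. (z \<bullet> b) *\<^sub>R J b x)"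
    using W x linear_sum[OF linear_J, of x "\<lambda>b. (z \<bullet> b) *\<^sub>R b" Basis]
    by (simp add: euclidean_representation linear_scale[OF linear_J] subset_iff)
  then show ?thesis using assms by (auto intro!: subspace_sum subspace_scale)
qed

text \<open>The usual averaging over the finite group generated by the \<open>J b\<close>, carried
  out one generator at a time.\<close>

lemma invariant_inner_product:
  assumes "F \<subseteq> Basis"
  shows "\<exists>Q. pos_form U Q \<and> (\<forall>b\<in>F. \<forall>x\<in>U. \<forall>y\<in>U. Q (J b x) (J b y) = Q x y)"
proof -
  have "finite F" using assms finite_Basis finite_subset by blast
  then show ?thesis using assms
  proof (induction F)
    case empty
    then show ?case using positive_form_exists[OF findim] by simp
  next
    case (insert c F)
    then obtain Q where Q: "pos_form U Q"
      and inv: "\<And>b x y. b \<in> F \<Longrightarrow> x \<in> U \<Longrightarrow> y \<in> U \<Longrightarrow> Q (J b x) (J b y) = Q x y" by auto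
    interpret Q: pos_form U Q by fact
    \<comment> \<open>Averaging over \<open>J c\<close> keeps the earlier invariances, as \<open>J b\<close> and \<open>J c\<close> anticommute.\<close>
    define Q' where "Q' x y = Q x y + Q (J c x) (J c y)" for x y
    have "pos_form U Q'"
    proof
      show "0 < Q' x x" if "x \<in> U" "x \<noteq> 0" for x
        using Q.pos[OF that] Q.nonneg[of "J c x"] that by (simp add: Q'_def)
    qed (auto simp: Q'_def linear_on_def Q.bilinear_simps J_add J_scale algebra_simps Q.sym Q.subspace)
    moreover have "Q' (J b x) (J b y) = Q' x y" if b: "b \<in> insert c F" and xy: "x \<in> U" "y \<in> U" for b x y
    proof (cases "b = c")
      case True
      \<comment> \<open>\<open>J c\<close> squares to a sign, which cancels in a bilinear form, so
        applying \<open>J c\<close> swaps the two summands of \<open>Q'\<close>.\<close>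
      have "pseudo_inner c c = 1 \<or> pseudo_inner c c = -1"
        using insert.prems pseudo_inner_Basis(2)[of c c] by simp
      then show ?thesis
        using xy by (auto simp: True Q'_def J_square Q.bilinear_simps Q.closed)
    next
      case False
      then have "pseudo_inner c b = 0" using b insert.prems pseudo_inner_Basis(1)[of c b] by auto
      then have "Q (J c (J b x)) (J c (J b y)) = Q (J b (J c x)) (J b (J c y))"
        using xy by (simp add: anticommute[of _ c b] Q.bilinear_simps Q.closed)
      then show ?thesis using b False xy by (simp add: Q'_def inv)
    qed
    ultimately show ?case by blast
  qed
qed

text \<open>By \<open>nd\<close> the restriction of \<open>B\<close> makes \<open>W\<close> an
  admissible module, so minimality bounds \<open>dim U\<close> by \<open>dim W\<close>.\<close>

lemma submodule_eq:
  assumes min: "minimal_admissible U J B"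
    and W: "subspace W" "W \<subseteq> U" "W \<noteq> {0}" "\<And>z x. x \<in> W \<Longrightarrow> J z x \<in> W"
    and nd: "\<And>x. x \<in> W \<Longrightarrow> (\<And>y. y \<in> W \<Longrightarrow> B x y = 0) \<Longrightarrow> x = 0"
  shows "W = U"
proof -
  obtain S where S: "finite S" "span S = U" using findim by (auto simp: findim_space_def)
  obtain c where c: "c \<subseteq> W" "independent c" "W \<subseteq> span c"
    using maximal_independent_subset[of W] by metis
  have cW: "span c = W" using c W(1) by (simp add: span_minimal subset_antisym)
  obtain d where d: "c \<subseteq> d" "d \<subseteq> U" "independent d" "U \<subseteq> span d"
    using maximal_independent_subset_extend[of c U] c W(2) by blast
  have dU: "span d = U" using d B.subspace by (simp add: span_minimal subset_antisym)
  have fd: "finite d" using independent_span_bound[OF S(1) d(3)] d(2) S(2) by auto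
  have "findim_space W"
    unfolding findim_space_def using cW fd d(1) finite_subset by blast
  then have "admissible_module W J B"
    using admissible W nd
    unfolding admissible_module_def clifford_module_def nondegenerate_symmetric_form_def linear_on_def
    by (auto simp: subset_iff)
  \<comment> \<open>\<open>W\<close> lives in the type of \<open>U\<close>, not in the competitor
    type of the definition, hence the comparison lemma.\<close>
  then have "dim U \<le> dim W" using minimal_admissible_dim_le[OF min _ W(3)] by blast
  then have "card d \<le> card c"
    using cW dU c(2) d(3) dim_span_eq_card_independent by metis
  then have "c = d" using d(1) fd card_seteq by blast
  then show ?thesis using cW dU by simp
qed

end

section \<open>Exactly three positive directions: the volume element and the form
  \<open>Phi\<close>\<close>

locale three_positive = admissible U J B
  for U :: "'u::real_vector set"
    and J :: "(real ^ 'r) \<times> (real ^ 's) \<Rightarrow> 'u \<Rightarrow> 'u"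
    and B :: "'u \<Rightarrow> 'u \<Rightarrow> real" +
  fixes e1 e2 e3 :: "(real ^ 'r) \<times> (real ^ 's)"
  assumes e_orth: "pseudo_inner e1 e2 = 0" "pseudo_inner e1 e3 = 0" "pseudo_inner e2 e3 = 0"
    and e_unit: "pseudo_inner e1 e1 = 1" "pseudo_inner e2 e2 = 1" "pseudo_inner e3 e3 = 1"
    and e_Basis: "\<And>b. b \<in> Basis \<Longrightarrow> b \<notin> {e1, e2, e3} \<Longrightarrow>
      pseudo_inner b b = - 1 \<and> pseudo_inner b e1 = 0 \<and> pseudo_inner b e2 = 0 \<and> pseudo_inner b e3 = 0"
begin

text \<open>The operator \<Omega> of the overview: the volume element of the positive part.\<close>

definition vol :: "'u \<Rightarrow> 'u" where "vol x = J e1 (J e2 (J e3 x))"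

lemma vol_closed [simp]: "x \<in> U \<Longrightarrow> vol x \<in> U"
  by (simp add: vol_def)

lemma e_orth': "pseudo_inner e2 e1 = 0" "pseudo_inner e3 e1 = 0" "pseudo_inner e3 e2 = 0"
  using e_orth by (simp_all add: pseudo_inner_sym)

lemma anti: "x \<in> U \<Longrightarrow> J e2 (J e1 x) = - J e1 (J e2 x)"
  "x \<in> U \<Longrightarrow> J e3 (J e1 x) = - J e1 (J e3 x)"
  "x \<in> U \<Longrightarrow> J e3 (J e2 x) = - J e2 (J e3 x)"
  by (auto intro!: anticommute e_orth')

lemma square: "x \<in> U \<Longrightarrow> J e1 (J e1 x) = - x" "x \<in> U \<Longrightarrow> J e2 (J e2 x) = - x"
  "x \<in> U \<Longrightarrow> J e3 (J e3 x) = - x"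
  by (simp_all add: J_square e_unit)

text \<open>Reversing three anticommuting factors gives one sign, the three squares
  \<open>-1\<close> give another.\<close>

lemma vol_vol: "x \<in> U \<Longrightarrow> vol (vol x) = x"
  by (simp add: vol_def anti square J_minus B.closed)

text \<open>For positive \<open>b\<close>, \<open>J b\<close> commutes with \<open>vol\<close> and
  squares to \<open>-1\<close>; for negative \<open>b\<close> it anticommutes with all three factors
  and squares to \<open>1\<close>. Both cases give the same sign.\<close>

lemma vol_J:
  assumes "b \<in> Basis" "x \<in> U"
  shows "J b (vol (J b x)) = - vol x"
proof (cases "b \<in> {e1, e2, e3}")
  case True
  then show ?thesis using assms by (auto simp: vol_def anti square J_minus B.closed)
next
  case False
  note b = e_Basis[OF assms(1) False]
  have "J b (J e1 y) = - J e1 (J b y)" "J b (J e2 y) = - J e2 (J b y)" "J b (J e3 y) = - J e3 (J b y)"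
    if "y \<in> U" for y
    using b that by (auto intro: anticommute)
  then show ?thesis using assms b by (simp add: vol_def J_square J_minus B.closed)
qed

definition Phi :: "'u \<Rightarrow> 'u \<Rightarrow> real" where "Phi x y = B x (vol y)"

sublocale Phi: sym_form U Phi
proof
  show "linear_on U (Phi x)" if "x \<in> U" for x
    using that by (simp add: linear_on_def Phi_def vol_def J_add J_scale B.bilinear_simps)
  show "Phi x y = Phi y x" if "x \<in> U" "y \<in> U" for x y
  proof -
    \<comment> \<open>Three uses of \<open>skew\<close> give a sign and reverse the factors;
      restoring their order gives a second sign.\<close>
    have "B (vol x) y = - B x (J e3 (J e2 (J e1 y)))" using that by (simp add: vol_def skew)
    also have "J e3 (J e2 (J e1 y)) = - vol y" using that by (simp add: vol_def anti J_minus B.closed)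
    finally show ?thesis using that B.sym[of "vol x" y] by (simp add: Phi_def B.bilinear_simps)
  qed
qed (rule B.subspace)

text \<open>The signs from \<open>skew\<close> and \<open>vol_J\<close> cancel. Under
  \<open>J b\<close> the form \<open>B\<close> itself is multiplied by
  \<open>pseudo_inner b b\<close>; the twist by \<open>vol\<close> removes this dependence on the
  sign of \<open>b\<close>.\<close>

lemma Phi_invariant:
  assumes "b \<in> Basis" "x \<in> U" "y \<in> U"
  shows "Phi (J b x) (J b y) = Phi x y"
  using assms by (simp add: Phi_def skew vol_J B.bilinear_simps)

text \<open>Definiteness is recorded as \<open>Phi = t * Q\<close> on the diagonal, which leaves the
  sign open.\<close>

lemma Phi_definite:
  assumes min: "minimal_admissible U J B"
  obtains Q t where "pos_form U Q" "t \<noteq> 0" "\<And>x. x \<in> U \<Longrightarrow> Phi x x = t * Q x x"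
proof -
  obtain Q where Q: "pos_form U Q"
    and "\<forall>b\<in>Basis. \<forall>x\<in>U. \<forall>y\<in>U. Q (J b x) (J b y) = Q x y"
    using invariant_inner_product[OF subset_refl] by (elim exE conjE)
  then have inv: "Q (J b x) (J b y) = Q x y" if "b \<in> Basis" "x \<in> U" "y \<in> U" for b x y
    using that by blast
  interpret Q: pos_form U Q by fact
  have nz: "U \<noteq> {0}" using min by (simp add: minimal_admissible_def)
  obtain a t where a: "a \<in> U" "a \<noteq> 0" "\<forall>y\<in>U. Phi a y = t * Q a y"
    by (rule Q.relative_eigenvector[OF findim nz Phi.sym_form_axioms])
  have "t \<noteq> 0"
  proof
    assume "t = 0"
    have "B a y = 0" if "y \<in> U" for y
      using bspec[OF a(3), of "vol y"] that \<open>t = 0\<close> by (simp add: Phi_def vol_vol)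
    then show False using nondegenerate a by blast
  qed
  \<comment> \<open>The eigenspace for \<open>t\<close>, to which \<open>submodule_eq\<close>
    applies.\<close>
  define W where "W = {x \<in> U. \<forall>y\<in>U. Phi x y = t * Q x y}"
  have "W = U"
  proof (rule submodule_eq[OF min])
    show sub: "subspace W"
      by (auto simp: subspace_def W_def Phi.bilinear_simps Q.bilinear_simps Q.closed algebra_simps)
    show WU: "W \<subseteq> U" by (auto simp: W_def)
    show "W \<noteq> {0}" using a by (auto simp: W_def)
    show J: "J z x \<in> W" if "x \<in> W" for z x
    proof (rule invariant_of_Basis[OF sub WU _ that])
      fix b :: "(real ^ 'r) \<times> (real ^ 's)" and x
      assume b: "b \<in> Basis" and x: "x \<in> W"
      have "Phi (J b x) y = t * Q (J b x) y" if y: "y \<in> U" for y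
      proof -
        \<comment> \<open>Since \<open>J b\<close> squares to a sign, every \<open>y\<close> is in
          its image, and both invariances apply to \<open>J b x\<close> and
          \<open>y\<close>.\<close>
        obtain k where k: "y = J b (k *\<^sub>R J b y)"
        proof
          show "y = J b ((- pseudo_inner b b) *\<^sub>R J b y)"
            using pseudo_inner_Basis(2)[OF b b] y by (auto simp: J_scale J_square J_minus)
        qed
        have "Phi (J b x) (J b (k *\<^sub>R J b y)) = t * Q (J b x) (J b (k *\<^sub>R J b y))"
          using x y b by (simp add: W_def Phi_invariant inv Q.closed)
        then show ?thesis using k by simp
      qed
      then show "J b x \<in> W" using x by (simp add: W_def)
    qed
    show "x = 0" if x: "x \<in> W" and n: "\<And>y. y \<in> W \<Longrightarrow> B x y = 0" for x
    proof -
      \<comment> \<open>The test vector \<open>vol x\<close> turns \<open>B\<close> into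
        \<open>Phi\<close>, which is \<open>t * Q\<close> on \<open>W\<close>.\<close>
      have "vol x \<in> W" using J x by (simp add: vol_def)
      then have "t * Q x x = 0" using n x by (force simp: W_def Phi_def)
      then show ?thesis using Q.pos[of x] x \<open>t \<noteq> 0\<close> by (auto simp: W_def)
    qed
  qed
  then have "Phi x x = t * Q x x" if "x \<in> U" for x using that by (auto simp: W_def)
  then show thesis using that Q \<open>t \<noteq> 0\<close> by blast
qed

text \<open>By \<open>eq\<close> and \<open>sq\<close>, \<open>J e \<circ> M e\<close> is determined
  by \<open>B\<close> and \<open>B'\<close>, hence the same for all three \<open>e\<close>. Call it
  \<open>R\<close>; exchanging the \<open>e\<close> freely yields
  \<open>Phi (R x) (R x) = - \<mu> * Phi x x\<close>.\<close>

lemma no_sign_reversal: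
  assumes min: "minimal_admissible U J B" and B': "sym_form U B'" and \<mu>: "\<mu> > 0"
    and closed: "\<And>e x. e \<in> {e1, e2, e3} \<Longrightarrow> x \<in> U \<Longrightarrow> M e x \<in> U"
    and scale: "\<And>e x c. e \<in> {e1, e2, e3} \<Longrightarrow> x \<in> U \<Longrightarrow> M e (c *\<^sub>R x) = c *\<^sub>R M e x"
    and sq: "\<And>e x. e \<in> {e1, e2, e3} \<Longrightarrow> x \<in> U \<Longrightarrow> M e (M e x) = \<mu> *\<^sub>R x"
    and eq: "\<And>e x y. e \<in> {e1, e2, e3} \<Longrightarrow> x \<in> U \<Longrightarrow> y \<in> U \<Longrightarrow> B (J e x) y = B' (M e x) y"
  shows False
proof -
  interpret B': sym_form U B' by fact
  have M0: "M e 0 = 0" if "e \<in> {e1, e2, e3}" for e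
    using scale[OF that B.closed(5), of 0] by simp
  have minus: "M e (- x) = - M e x" if "e \<in> {e1, e2, e3}" "x \<in> U" for e x
    using scale[OF that, of "-1"] by simp
  have JM: "B (J e (M e x)) y = \<mu> * B' x y" if "e \<in> {e1, e2, e3}" "x \<in> U" "y \<in> U" for e x y
    using that by (simp add: eq closed sq B'.scale_left del: insert_iff)
  have nz: "x = 0" if x: "x \<in> U" and "J e1 (M e1 x) = 0" for x
  proof -
    have "M e1 x = 0" using J_injective[of "M e1 x" e1] that closed e_unit by simp
    then show ?thesis using sq[of e1 x] x M0 \<mu> by simp
  qed
  \<comment> \<open>By \<open>JM\<close>, non-degeneracy passes from \<open>B\<close> to
    \<open>B'\<close>.\<close>
  have B'_cancel: "x = y" if xy: "x \<in> U" "y \<in> U" and "\<And>w. w \<in> U \<Longrightarrow> B' x w = B' y w" for x y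
  proof -
    have "B (J e1 (M e1 (x - y))) w = 0" if w: "w \<in> U" for w
      using that xy \<open>\<And>w. w \<in> U \<Longrightarrow> B' x w = B' y w\<close>[OF w] by (simp add: JM B.closed B'.diff_left)
    then have "J e1 (M e1 (x - y)) = 0" using nondegenerate xy by (simp add: closed B.closed)
    then show ?thesis using nz[of "x - y"] xy B.closed by simp
  qed
  have JM_eq: "J e (M e x) = J e' (M e' x)" if "e \<in> {e1, e2, e3}" "e' \<in> {e1, e2, e3}" "x \<in> U" for e e' x
    using that by (intro cancel) (simp_all add: JM closed del: insert_iff)
  \<comment> \<open>The opposite product is independent of \<open>e\<close> too: paired with
    \<open>y\<close> under \<open>B'\<close> it gives \<open>- B x y\<close>.\<close>
  have MJ_eq: "M e (J e x) = M e' (J e' x)" if "e \<in> {e1, e2, e3}" "e' \<in> {e1, e2, e3}" "x \<in> U" for e e' x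
  proof (rule B'_cancel)
    have "B (J e (J e x)) y = B (J e' (J e' x)) y" for y
      using that by (auto simp: square)
    then show "B' (M e (J e x)) y = B' (M e' (J e' x)) y" if "y \<in> U" for y
      using that \<open>x \<in> U\<close> \<open>e \<in> _\<close> \<open>e' \<in> _\<close> by (simp add: eq[symmetric] del: insert_iff)
  qed (use that in \<open>simp_all add: closed del: insert_iff\<close>)
  obtain x where x: "x \<in> U" "x \<noteq> 0"
    using min B.closed(5) by (auto simp: minimal_admissible_def)
  define y where "y = J e1 (M e1 x)"
  have y: "y \<in> U" "y \<noteq> 0" using x nz by (auto simp: y_def closed)
  \<comment> \<open>Writing \<open>R\<close> with \<open>e3\<close> lets the innermost factor of
    \<open>vol\<close> cancel.\<close>
  have "J e3 y = - M e3 x"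
    unfolding y_def using JM_eq[of e1 e3 x] x by (simp add: square closed)
  then have vy: "vol y = - J e1 (J e2 (M e3 x))"
    using x by (simp add: vol_def J_minus closed)
  have M3: "M e3 x = - M e2 (J e2 (J e3 x))"
    using MJ_eq[of e2 e3 "J e3 x"] x by (simp add: square minus)
  \<comment> \<open>Two uses of \<open>JM\<close> around the symmetry of \<open>B'\<close> show that
    \<open>R\<close> is symmetric for \<open>B\<close>, so it moves to the other argument.\<close>
  have "B y (J e1 (J e2 (M e3 x))) = \<mu> * B' (J e1 (J e2 (M e3 x))) x"
    using x B'.sym[of x] by (simp add: y_def JM closed)
  also have "\<dots> = B (J e1 (M e1 (J e1 (J e2 (M e3 x))))) x"
    using x by (simp add: JM closed)
  also have "M e1 (J e1 (J e2 (M e3 x))) = - M e2 (M e3 x)"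
    using MJ_eq[of e1 e2 "J e2 (M e3 x)"] x by (simp add: closed square minus)
  also have "\<dots> = \<mu> *\<^sub>R J e2 (J e3 x)"
    unfolding M3 using x by (simp add: closed minus sq)
  also have "B (J e1 (\<mu> *\<^sub>R J e2 (J e3 x))) x = \<mu> * Phi x x"
    using x B.sym[of x "vol x"] by (simp add: J_scale B.scale_left Phi_def vol_def)
  finally have Phi: "Phi y y = - \<mu> * Phi x x"
    using x y by (simp add: Phi_def vy B.minus_right closed)
  obtain Q t where Q: "pos_form U Q" and t: "t \<noteq> 0" and PQ: "\<And>x. x \<in> U \<Longrightarrow> Phi x x = t * Q x x"
    using Phi_definite[OF min] by metis
  have "t * (Q y y + \<mu> * Q x x) = 0"
    using Phi x(1) y(1) by (simp add: PQ algebra_simps)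
  then show False
    using t \<mu> pos_form.pos[OF Q x] pos_form.pos[OF Q y] by (simp add: add_pos_pos less_imp_neq[symmetric])
qed

end

section \<open>Linear maps that respect null cones\<close>

lemma injective_imp_CARD_le:
  fixes f :: "real ^ 'a \<Rightarrow> real ^ 'b"
  assumes "linear f" "\<And>x. f x = 0 \<Longrightarrow> x = 0"
  shows "CARD('a) \<le> CARD('b)"
proof -
  have "inj f" using assms linear_injective_0 by blast
  then have "dim (range f) = dim (UNIV :: (real ^ 'a) set)"
    using dim_image_eq[OF assms(1), of UNIV] by simp
  then show ?thesis using dim_subset_UNIV[of "range f"] by simp
qed

text \<open>The given \<open>w\<close> serves as the direction of \<open>a = 0\<close>.\<close>

lemma multiple_of_unit_vector:
  fixes a w :: "'a::euclidean_space"
  assumes "w \<bullet> w = 1"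
  obtains c u where "a = c *\<^sub>R u" "u \<bullet> u = 1" "a \<bullet> a = c * c"
proof (cases "a = 0")
  case True
  then show ?thesis using that[of 0 w] assms by simp
next
  case False
  then show ?thesis
    using that[of "norm a" "a /\<^sub>R norm a"] by (simp add: dot_square_norm power2_eq_square)
qed

text \<open>For unit vectors \<open>u\<close>, \<open>v\<close> of the two factors both
  \<open>(u, v)\<close> and \<open>(u, - v)\<close> are null. Adding and subtracting the two
  conditions on the pulled-back form \<open>p\<close> determines \<open>p\<close> up to one
  constant.\<close>

lemma same_null_cone_imp_proportional:
  fixes h :: "(real ^ 'r) \<times> (real ^ 's) \<Rightarrow> (real ^ 'p) \<times> (real ^ 'q)"
  assumes h: "linear h"
    and null: "\<And>z. pseudo_inner z z = 0 \<Longrightarrow> pseudo_inner (h z) (h z) = 0"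
  obtains l where "\<And>z. pseudo_inner (h z) (h z) = l * pseudo_inner z z"
proof -
  define p where "p x y = pseudo_inner (h x) (h y)" for x y
  have add: "p (x + y) z = p x z + p y z" "p z (x + y) = p z x + p z y" for x y z
    by (simp_all add: p_def linear_add[OF h] pseudo_inner_add)
  have scale: "p (c *\<^sub>R x) y = c * p x y" "p x (c *\<^sub>R y) = c * p x y" for c x y
    by (simp_all add: p_def linear_scale[OF h] pseudo_inner_scale)
  have sym: "p x y = p y x" for x y by (simp add: p_def pseudo_inner_sym)
  have unit: "p (u, 0) (0, v) = 0" "p (u, 0) (u, 0) = - p (0, v) (0, v)"
    if "u \<bullet> u = 1" "v \<bullet> v = 1" for u :: "real ^ 'r" and v :: "real ^ 's"
  proof -
    have "p ((u, 0) + c *\<^sub>R (0, v)) ((u, 0) + c *\<^sub>R (0, v)) = 0" if "c = 1 \<or> c = -1" for c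
      unfolding p_def by (rule null) (use that \<open>u \<bullet> u = 1\<close> \<open>v \<bullet> v = 1\<close> in \<open>auto simp: pseudo_inner_eq\<close>)
    from this[of 1] this[of "-1"] show "p (u, 0) (0, v) = 0" "p (u, 0) (u, 0) = - p (0, v) (0, v)"
      unfolding add scale sym[of "(0, v)" "(u, 0)"] by (simp_all add: algebra_simps)
  qed
  define v0 :: "real ^ 's" where "v0 = axis undefined 1"
  define u0 :: "real ^ 'r" where "u0 = axis undefined 1"
  have uv0: "u0 \<bullet> u0 = 1" "v0 \<bullet> v0 = 1" by (simp_all add: u0_def v0_def inner_axis_axis)
  define l where "l = p (u0, 0) (u0, 0)"
  show thesis
  proof (rule that[of l])
    fix z :: "(real ^ 'r) \<times> (real ^ 's)"
    obtain c u where u: "fst z = c *\<^sub>R u" "u \<bullet> u = 1" "fst z \<bullet> fst z = c * c"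
      by (rule multiple_of_unit_vector[OF uv0(1)])
    obtain d v where v: "snd z = d *\<^sub>R v" "v \<bullet> v = 1" "snd z \<bullet> snd z = d * d"
      by (rule multiple_of_unit_vector[OF uv0(2)])
    have z: "z = c *\<^sub>R (u, 0) + d *\<^sub>R (0, v)" using u v by (simp add: prod_eq_iff)
    \<comment> \<open>Any \<open>u\<close> is compared with \<open>u0\<close> through the common
      partner \<open>v\<close>.\<close>
    have "p (0, v) (0, v) = - l" "p (u, 0) (u, 0) = l"
      using unit[OF uv0(1) v(2)] unit[OF u(2) v(2)] by (simp_all add: l_def)
    then have "p z z = l * (c * c - d * d)"
      unfolding z add scale sym[of "(0, v)" "(u, 0)"] unit(1)[OF u(2) v(2)] by (simp add: algebra_simps)
    then show "pseudo_inner (h z) (h z) = l * pseudo_inner z z"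
      using u v by (simp add: p_def pseudo_inner_eq)
  qed
qed

text \<open>With a positive factor, \<open>h\<close> followed by projection would embed the positive
  part in the positive part and the negative part in the negative part, forcing
  \<open>r = s\<close>.\<close>

lemma same_null_cone_imp_negative_factor:
  fixes h :: "(real ^ 'r) \<times> (real ^ 's) \<Rightarrow> (real ^ 's) \<times> (real ^ 'r)"
  assumes h: "linear h" and ne: "CARD('r) \<noteq> CARD('s)"
    and null: "\<And>z. pseudo_inner (h z) (h z) = 0 \<longleftrightarrow> pseudo_inner z z = 0"
  obtains \<mu> where "\<mu> > 0" "\<And>z. pseudo_inner (h z) (h z) = - \<mu> * pseudo_inner z z"
proof -
  obtain l where l: "\<And>z. pseudo_inner (h z) (h z) = l * pseudo_inner z z"
    using same_null_cone_imp_proportional[OF h] null by blast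
  have "l \<noteq> 0"
    using l[of "(axis undefined 1, 0)"] null[of "(axis undefined 1, 0)"]
    by (auto simp: pseudo_inner_eq inner_axis_axis)
  moreover have "\<not> l > 0"
  proof
    assume "l > 0"
    have lin: "linear (\<lambda>a. fst (h (a, 0)))" "linear (\<lambda>b. snd (h (0, b)))"
      using linear_add[OF h, of "(_, 0)" "(_, 0)"] linear_scale[OF h, of _ "(_, 0)"]
        linear_add[OF h, of "(0, _)" "(0, _)"] linear_scale[OF h, of _ "(0, _)"]
      by (auto intro!: linearI)
    have "CARD('r) \<le> CARD('s)"
    proof (rule injective_imp_CARD_le[OF lin(1)])
      fix a assume "fst (h (a, 0)) = 0"
      then have "l * (a \<bullet> a) = - (snd (h (a, 0)) \<bullet> snd (h (a, 0)))"
        using l[of "(a, 0)"] by (simp add: pseudo_inner_eq)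
      then have "l * (a \<bullet> a) \<le> 0" by simp
      then have "a \<bullet> a \<le> 0" using \<open>l > 0\<close> by (simp add: mult_le_0_iff)
      then show "a = 0" using inner_ge_zero[of a] by (metis inner_eq_zero_iff order_antisym)
    qed
    moreover have "CARD('s) \<le> CARD('r)"
    proof (rule injective_imp_CARD_le[OF lin(2)])
      fix b assume "snd (h (0, b)) = 0"
      then have "0 \<le> l * - (b \<bullet> b)" using l[of "(0, b)"] inner_ge_zero[of "fst (h (0, b))"] by (simp add: pseudo_inner_eq)
      then have "b \<bullet> b \<le> 0" using \<open>l > 0\<close> by (simp add: mult_le_0_iff zero_le_mult_iff)
      then show "b = 0" using inner_ge_zero[of b] by (metis inner_eq_zero_iff order_antisym)
    qed
    ultimately show False using ne by simp
  qed
  ultimately show thesis using l that[of "- l"] by auto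
qed

text \<open>\<open>J z\<close> is invertible for non-null \<open>z\<close> and nilpotent for null
  \<open>z\<close>. The right-hand side involves only \<open>B (J z x) y\<close>, which an
  isomorphism transports.\<close>

lemma (in admissible) nonnull_iff:
  assumes "U \<noteq> {0}"
  shows "pseudo_inner z z \<noteq> 0 \<longleftrightarrow> (\<forall>x\<in>U. (\<forall>y\<in>U. B (J z x) y = 0) \<longrightarrow> x = 0)"
proof
  assume "pseudo_inner z z \<noteq> 0"
  then show "\<forall>x\<in>U. (\<forall>y\<in>U. B (J z x) y = 0) \<longrightarrow> x = 0"
    using J_injective nondegenerate J_closed by metis
next
  assume R: "\<forall>x\<in>U. (\<forall>y\<in>U. B (J z x) y = 0) \<longrightarrow> x = 0"
  obtain x where x: "x \<in> U" "x \<noteq> 0" using assms B.closed(5) by auto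
  show "pseudo_inner z z \<noteq> 0"
  proof
    assume "pseudo_inner z z = 0"
    then have "J z (J z x) = 0" using x by (simp add: J_square)
    then have "J z x = 0" using R x by (simp add: B.zero_left)
    then show False using R x by (simp add: B.zero_left)
  qed
qed

section \<open>Central elements and the data induced by a Lie algebra isomorphism\<close>

lemma (in admissible) h_bracket_zero:
  assumes "y \<in> U"
  shows "h_bracket J B 0 y = 0"
proof (rule h_bracket_unique)
  fix z
  have "pseudo_inner z (h_bracket J B 0 y) = 0"
    using assms by (simp add: h_bracket_eq[OF admissible] B.closed J_zero B.zero_left)
  then show "pseudo_inner z (h_bracket J B 0 y) = pseudo_inner z 0" by (simp add: pseudo_inner_eq)
qed

text \<open>A basis vector \<open>b\<close> is non-null, so \<open>J b\<close> is injective. Hence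
  the Lie algebra has no central elements outside the summand of the \<open>z\<close>.\<close>

lemma (in admissible) central_imp_zero:
  assumes x: "x \<in> U" and c: "\<And>y. y \<in> U \<Longrightarrow> h_bracket J B x y = 0"
  shows "x = 0"
proof -
  obtain b :: "(real ^ 'r) \<times> (real ^ 's)" where b: "b \<in> Basis" using nonempty_Basis by blast
  have "B (J b x) y = 0" if "y \<in> U" for y
    using h_bracket_eq[OF admissible x that, of b] c[OF that] by (simp add: pseudo_inner_eq)
  then have "J b x = 0" using nondegenerate x by simp
  then show ?thesis using J_injective[OF x \<open>J b x = 0\<close>] pseudo_inner_Basis(2)[OF b b] by auto
qed

lemma lie_isomorphic_sym:
  assumes L: "subspace L" and br: "\<And>x y. x \<in> L \<Longrightarrow> y \<in> L \<Longrightarrow> br x y \<in> L"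
    and iso: "lie_isomorphic L br L' br'"
  shows "lie_isomorphic L' br' L br"
proof -
  obtain f where f: "linear_on L f" "bij_betw f L L'"
    "\<And>x y. x \<in> L \<Longrightarrow> y \<in> L \<Longrightarrow> f (br x y) = br' (f x) (f y)"
    using iso by (auto simp: lie_isomorphic_def)
  define g where "g = inv_into L f"
  have g: "bij_betw g L' L" using f(2) by (simp add: g_def bij_betw_inv_into)
  have gL: "g y \<in> L" "f (g y) = y" if "y \<in> L'" for y
    using f(2) that g by (auto simp: g_def bij_betw_inv_into_right dest: bij_betwE)
  have gf: "g (f x) = x" if "x \<in> L" for x using f(2) that by (simp add: g_def bij_betw_inv_into_left)
  have "linear_on L' g"
    unfolding linear_on_def
  proof (intro conjI ballI allI)
    fix x y assume "x \<in> L'" "y \<in> L'"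
    then show "g (x + y) = g x + g y"
      using f(1) gf[of "g x + g y"] gL subspace_add[OF L] by (simp add: linear_on_def)
  next
    fix c x assume "x \<in> L'"
    then show "g (c *\<^sub>R x) = c *\<^sub>R g x"
      using f(1) gf[of "c *\<^sub>R g x"] gL subspace_scale[OF L] by (simp add: linear_on_def)
  qed
  moreover have "g (br' x y) = br (g x) (g y)" if "x \<in> L'" "y \<in> L'" for x y
    using that f(3)[of "g x" "g y"] gf[OF br[of "g x" "g y"]] gL by simp
  ultimately show ?thesis using g unfolding lie_isomorphic_def by blast
qed

lemma linear_negate_snd: "linear (\<lambda>x. (fst x, - snd x))"
  by (rule linearI) simp_all

text \<open>The isomorphism is block triangular: \<open>A\<close> is its action modulo the centre,
  \<open>d\<close> its restriction to the centre. Pairing the bracket relation with \<open>z\<close>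
  brings in the adjoint \<open>h\<close> of \<open>d\<close>.\<close>

lemma lie_isomorphism_induces:
  fixes J :: "(real ^ 'r) \<times> (real ^ 's) \<Rightarrow> 'u::real_vector \<Rightarrow> 'u"
    and K :: "(real ^ 'p) \<times> (real ^ 'q) \<Rightarrow> 'v::real_vector \<Rightarrow> 'v"
  assumes U: "admissible_module U J B" and V: "admissible_module V K C"
    and iso: "lie_isomorphic (N_carrier U) (N_bracket J B) (N_carrier V) (N_bracket K C)"
  obtains A h where "linear_on U A" "bij_betw A U V" "linear h"
    "\<And>z x y. x \<in> U \<Longrightarrow> y \<in> U \<Longrightarrow> C (K z (A x)) (A y) = B (J (h z) x) y"
proof -
  interpret U: admissible U J B using U by unfold_locales
  interpret V: admissible V K C using V by unfold_locales
  obtain f where f: "linear_on (N_carrier U) f" "bij_betw f (N_carrier U) (N_carrier V)"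
    and fbr: "\<And>p q. p \<in> N_carrier U \<Longrightarrow> q \<in> N_carrier U \<Longrightarrow>
      f (N_bracket J B p q) = N_bracket K C (f p) (f q)"
    using iso unfolding lie_isomorphic_def by blast
  have mem: "p \<in> N_carrier U \<longleftrightarrow> fst p \<in> U" "q \<in> N_carrier V \<longleftrightarrow> fst q \<in> V" for p q
    by (auto simp: N_carrier_def mem_Times_iff)
  have f_add: "f (p + q) = f p + f q" if "fst p \<in> U" "fst q \<in> U" for p q
    using f(1) that by (simp add: linear_on_def mem)
  have f_scale: "f (c *\<^sub>R p) = c *\<^sub>R f p" if "fst p \<in> U" for p c
    using f(1) that by (simp add: linear_on_def mem)
  have f0: "f 0 = 0" using f_scale[of 0 0] U.B.closed(5) by simp
  have f_mem: "fst (f p) \<in> V" if "fst p \<in> U" for p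
    using f(2) that by (auto simp: mem[symmetric] dest: bij_betwE)
  have f_inj: "p = q" if "f p = f q" "fst p \<in> U" "fst q \<in> U" for p q
    using f(2) that by (auto simp: mem[symmetric] bij_betw_def dest: inj_onD)
  have f_surj: "\<exists>p. fst p \<in> U \<and> f p = q" if "fst q \<in> V" for q
    using bij_betw_imp_surj_on[OF f(2)] that mem by (metis imageE)
  have bracket: "f (0, h_bracket J B (fst p) (fst q)) = (0, h_bracket K C (fst (f p)) (fst (f q)))"
    if "fst p \<in> U" "fst q \<in> U" for p q
    using fbr[of p q] that by (simp add: mem N_bracket_def)
  have f_central: "fst (f (0, w)) = 0" for w
  proof (rule V.central_imp_zero)
    show "fst (f (0, w)) \<in> V" using f_mem U.B.closed(5) by simp
    fix y assume "y \<in> V"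
    then obtain q where q: "fst q \<in> U" "f q = (y, 0)" using f_surj[of "(y, 0)"] by auto
    show "h_bracket K C (fst (f (0, w))) y = 0"
      using bracket[of "(0, w)" q] q U.B.closed(5) U.h_bracket_zero[of "fst q"] f0 by (simp add: zero_prod_def)
  qed
  define A where "A x = fst (f (x, 0))" for x
  define d where "d w = snd (f (0, w))" for w
  have fst_f: "fst (f p) = A (fst p)" if "fst p \<in> U" for p
    using f_add[of "(fst p, 0)" "(0, snd p)"] that U.B.closed(5) f_central[of "snd p"]
    by (simp add: A_def)
  have d: "f (0, w) = (0, d w)" for w using f_central[of w] by (simp add: d_def prod_eq_iff)
  have "linear d"
    by (rule linearI)
      (use f_add[of "(0, _)" "(0, _)"] f_scale[of "(0, _)"] U.B.closed(5) in \<open>simp_all add: d_def\<close>)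
  have A_lin: "linear_on U A"
    using f_add[of "(_, 0)" "(_, 0)"] f_scale[of "(_, 0)"] by (simp add: linear_on_def A_def)
  have dbr: "d (h_bracket J B x y) = h_bracket K C (A x) (A y)" if "x \<in> U" "y \<in> U" for x y
    using bracket[of "(x, 0)" "(y, 0)"] that by (simp add: A_def d_def)
  have A_bij: "bij_betw A U V"
  proof (rule bij_betwI')
    show "A x \<in> V" if "x \<in> U" for x using f_mem[of "(x, 0)"] that by (simp add: A_def)
    show "\<exists>x\<in>U. y = A x" if "y \<in> V" for y
      using f_surj[of "(y, 0)"] that fst_f by fastforce
    fix x y assume xy: "x \<in> U" "y \<in> U"
    show "A x = A y \<longleftrightarrow> x = y"
    proof
      assume "A x = A y"
      \<comment> \<open>The brackets of \<open>x - y\<close> are killed by \<open>d\<close>, hence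
        vanish by injectivity of \<open>f\<close>; so \<open>x - y\<close> is central.\<close>
      then have A0: "A (x - y) = 0"
        using xy A_lin U.B.closed(3)[of y] unfolding linear_on_def
        by (metis (no_types, lifting) add.right_inverse diff_conv_add_uminus scaleR_minus1_left)
      have "x - y = 0"
      proof (rule U.central_imp_zero)
        show "x - y \<in> U" using xy U.B.closed by simp
        fix w assume w: "w \<in> U"
        have "A w \<in> V" using f_mem[of "(w, 0)"] w by (simp add: A_def)
        then have "h_bracket K C 0 (A w) = 0" by (rule V.h_bracket_zero)
        then have "f (0, h_bracket J B (x - y) w) = f (0, 0)"
          using dbr[of "x - y" w] xy w A0 U.B.closed f0 by (simp add: d zero_prod_def)
        then show "h_bracket J B (x - y) w = 0" using f_inj U.B.closed(5) by fastforce
      qed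
      then show "x = y" by simp
    qed simp
  qed
  \<comment> \<open>\<open>adjoint\<close> refers to the Euclidean inner product; negating the
    second component before and after makes it the adjoint for \<open>pseudo_inner\<close>.\<close>
  define h where "h z = (fst (adjoint d (fst z, - snd z)), - snd (adjoint d (fst z, - snd z)))" for z
  have "linear h"
    using linear_compose[OF linear_compose[OF linear_negate_snd adjoint_linear[OF \<open>linear d\<close>]]
        linear_negate_snd]
    by (simp add: h_def[abs_def] o_def)
  have h: "pseudo_inner z (d w) = pseudo_inner (h z) w" for z w
    using adjoint_works[OF \<open>linear d\<close>, of w "(fst z, - snd z)"]
    by (simp add: h_def pseudo_inner_eq inner_prod_def inner_commute)
  have "C (K z (A x)) (A y) = B (J (h z) x) y" if xy: "x \<in> U" "y \<in> U" for z x y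
  proof -
    have "A x \<in> V" "A y \<in> V" using A_bij xy by (auto dest: bij_betwE)
    then have "C (K z (A x)) (A y) = pseudo_inner z (h_bracket K C (A x) (A y))"
      by (simp add: h_bracket_eq[OF V])
    then show ?thesis using xy by (simp add: dbr[symmetric] h h_bracket_eq[OF U])
  qed
  then show thesis using that A_lin A_bij \<open>linear h\<close> by blast
qed

theorem theorem9:
  fixes U :: "'u::real_vector set"
    and J :: "(real ^ 'r::finite) \<times> (real ^ 's::finite) \<Rightarrow> 'u \<Rightarrow> 'u"
    and B :: "'u \<Rightarrow> 'u \<Rightarrow> real"
    and V :: "'v::real_vector set"
    and K :: "(real ^ 's) \<times> (real ^ 'r) \<Rightarrow> 'v \<Rightarrow> 'v"
    and C :: "'v \<Rightarrow> 'v \<Rightarrow> real"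
  assumes "(CARD('r), CARD('s)) \<in> {(3, 1), (3, 2), (3, 7), (3, 11)}"
    and "minimal_admissible U J B"
    and "minimal_admissible V K C"
  shows "\<not> lie_isomorphic (N_carrier U) (N_bracket J B) (N_carrier V) (N_bracket K C)"
proof
  assume iso: "lie_isomorphic (N_carrier U) (N_bracket J B) (N_carrier V) (N_bracket K C)"
  \<comment> \<open>\<open>r = 3\<close> supplies the three factors of \<open>vol\<close>;
    \<open>r \<noteq> s\<close> makes the factor of \<open>h\<close> negative.\<close>
  have r: "CARD('r) = 3" and rs: "CARD('r) \<noteq> CARD('s)" using assms(1) by auto
  have adm: "admissible_module U J B" "admissible_module V K C" and nz: "U \<noteq> {0}" "V \<noteq> {0}"
    using assms(2,3) by (simp_all add: minimal_admissible_def)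
  interpret U: admissible U J B using adm by unfold_locales
  interpret V: admissible V K C using adm by unfold_locales
  \<comment> \<open>The inverse direction gives \<open>A\<close> from \<open>V\<close> to
    \<open>U\<close>, so that the operators of \<open>V\<close> can be conjugated to act on
    \<open>U\<close>.\<close>
  have "lie_isomorphic (N_carrier V) (N_bracket K C) (N_carrier U) (N_bracket J B)"
  proof (rule lie_isomorphic_sym[OF _ _ iso])
    show "subspace (N_carrier U)"
      unfolding N_carrier_def using U.B.subspace by (intro subspace_Times) auto
  qed (auto simp: N_carrier_def N_bracket_def U.B.closed)
  then obtain A h where A: "linear_on V A" "bij_betw A V U" and h: "linear h"
    and AB: "\<And>z x y. x \<in> V \<Longrightarrow> y \<in> V \<Longrightarrow> B (J z (A x)) (A y) = C (K (h z) x) y"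
    using lie_isomorphism_induces[OF adm(2,1)] by metis
  define A' where "A' = inv_into V A"
  have A'_V: "A' x \<in> V" "A (A' x) = x" if "x \<in> U" for x
    using A(2) that by (auto simp: A'_def bij_betw_inv_into_right bij_betw_def inv_into_into)
  have A'_A: "A' (A v) = v" and A_U: "A v \<in> U" if "v \<in> V" for v
    using A(2) that by (auto simp: A'_def bij_betw_inv_into_left dest: bij_betwE)
  have A_add: "A (x + y) = A x + A y" if "x \<in> V" "y \<in> V" for x y
    using A(1) that by (auto simp: linear_on_def)
  have A_scale: "A (c *\<^sub>R x) = c *\<^sub>R A x" if "x \<in> V" for x c
    using A(1) that by (auto simp: linear_on_def)
  have A'_add: "A' (x + y) = A' x + A' y" if "x \<in> U" "y \<in> U" for x y
    using A_add[of "A' x" "A' y"] A'_V that A'_A[of "A' x + A' y"] V.B.closed by simp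
  have A'_scale: "A' (c *\<^sub>R x) = c *\<^sub>R A' x" if "x \<in> U" for x c
    using A_scale[of "A' x" c] A'_V that A'_A[of "c *\<^sub>R A' x"] V.B.closed by simp
  have A_0: "A v = 0 \<longleftrightarrow> v = 0" if "v \<in> V" for v
    using A_scale[OF V.B.closed(5), of 0] A'_A that V.B.closed(5) by (metis scaleR_zero_left)
  have "pseudo_inner (h z) (h z) \<noteq> 0 \<longleftrightarrow> pseudo_inner z z \<noteq> 0" for z
  proof -
    have "pseudo_inner z z \<noteq> 0 \<longleftrightarrow> (\<forall>x\<in>A ` V. (\<forall>y\<in>A ` V. B (J z x) y = 0) \<longrightarrow> x = 0)"
      using U.nonnull_iff[OF nz(1)] bij_betw_imp_surj_on[OF A(2)] by simp
    also have "\<dots> \<longleftrightarrow> (\<forall>x\<in>V. (\<forall>y\<in>V. C (K (h z) x) y = 0) \<longrightarrow> x = 0)"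
      using A_0 AB by simp
    finally show ?thesis using V.nonnull_iff[OF nz(2)] by simp
  qed
  then obtain \<mu> where \<mu>: "\<mu> > 0" "\<And>z. pseudo_inner (h z) (h z) = - \<mu> * pseudo_inner z z"
    using same_null_cone_imp_negative_factor[OF h rs] by metis
  obtain a1 a2 a3 :: 'r where a: "UNIV = {a1, a2, a3}" "a1 \<noteq> a2" "a1 \<noteq> a3" "a2 \<noteq> a3"
    using r by (auto simp: card_3_iff)
  define e :: "'r \<Rightarrow> (real ^ 'r) \<times> (real ^ 's)" where "e a = (axis a 1, 0)" for a
  have e: "pseudo_inner (e a) (e b) = (if a = b then 1 else 0)" for a b
    by (simp add: e_def pseudo_inner_eq inner_axis_axis)
  interpret three_positive U J B "e a1" "e a2" "e a3"
  proof
    fix b :: "(real ^ 'r) \<times> (real ^ 's)"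
    assume b: "b \<in> Basis" "b \<notin> {e a1, e a2, e a3}"
    \<comment> \<open>The three indices exhaust \<open>'r\<close>, so any other basis vector is
      negative.\<close>
    have "\<exists>v\<in>Basis. b = (0, v)"
    proof (rule ccontr)
      assume "\<not> ?thesis"
      then obtain i where "b = e i" using b(1) by (auto simp: Basis_prod_def Basis_vec_def e_def)
      moreover have "i \<in> {a1, a2, a3}" using a(1) by blast
      ultimately show False using b(2) by auto
    qed
    then show "pseudo_inner b b = - 1 \<and> pseudo_inner b (e a1) = 0 \<and> pseudo_inner b (e a2) = 0 \<and>
        pseudo_inner b (e a3) = 0"
      by (auto simp: e_def pseudo_inner_eq)
  qed (use a in \<open>auto simp: e\<close>)
  show False
  proof (rule no_sign_reversal[OF assms(2) _ \<mu>(1)])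
    show "sym_form U (\<lambda>x y. C (A' x) (A' y))"
      by unfold_locales
        (auto simp: linear_on_def A'_add A'_scale A'_V V.B.bilinear_simps U.B.subspace V.B.sym)
    let ?M = "\<lambda>z x. A (K (h z) (A' x))"
    fix z x assume z: "z \<in> {e a1, e a2, e a3}" and x: "x \<in> U"
    show "?M z x \<in> U" using x by (simp add: A_U A'_V)
    show "?M z (c *\<^sub>R x) = c *\<^sub>R ?M z x" for c
      using x by (simp add: A'_V A'_scale A_scale V.J_scale)
    \<comment> \<open>\<open>K (h z)\<close> squares to \<open>- pseudo_inner (h z) (h z)\<close>,
      which is \<open>\<mu>\<close> because \<open>pseudo_inner z z = 1\<close>.\<close>
    show "?M z (?M z x) = \<mu> *\<^sub>R x"
      using x z by (auto simp: A'_A A'_V V.J_square \<mu>(2) e A_scale)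
    show "B (J z x) y = C (A' (?M z x)) (A' y)" if "y \<in> U" for y
      using AB[of "A' x" "A' y" z] x that by (simp add: A'_A A'_V)
  qed
qed

end
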